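(* Let $f=f(x_1,\dots,x_p)$ be a tensor product spline on $[0,1]^p$ and let $j\in\{1,\dots,p\}$. Then the function $$x_{-j}\mapsto\int_{[0,1]}f(x_1,\dots,x_p)\,dx_j$$ is a tensor product spline in the smaller tensor product space that is obtained when omitting the $j$-th marginal spline basis from the tensor product. If $b\in\mathbb{R}^D$ is the vector of coefficients of $f$ with respect to the tensor product B-splines, then $$(I_{d_1}\otimes\dots\otimes I_{d_{j-1}}\otimes A_j\otimes I_{d_{j+1}}\otimes\dots\otimes I_{d_p})\,b$$ is the vector of coefficients of this function with respect to the tensor product B-splines in the smaller tensor product spline space, where $A_j$ is the $1\times d_j$ matrix $$A_j=\left(\int_{[0,1]}B^{(j)}_1(x_j)\,dx_j,\ \dots,\ \int_{[0,1]}B^{(j)}_{d_j}(x_j)\,dx_j\right).$$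
   Context: Let $p\geq 2$. For each $j=1,\dots,p$ let $B^{(j)}_1,\dots,B^{(j)}_{d_j}$ be the $j$-th marginal basis: a cubic B-spline basis of dimension $d_j$ on the unit interval $[0,1]$ with equidistant knots (a linearly independent family of continuous functions on $[0,1]$). Let $D=\prod_{j=1}^p d_j$. The tensor product B-splines are the $D$ functions on $[0,1]^p$ $$x\mapsto\prod_{j=1}^pB^{(j)}_{l_j}(x_j),\qquad 1\le l_j\le d_j,$$ enumerated in lexicographic order of $(l_1,\dots,l_p)$ with the last index $l_p$ varying fastest (consistent with the Kronecker product $\otimes$). A tensor product spline is a linear combination $f=\sum_{l=1}^D b_lB_l$ of the tensor product B-splines $B_1,\dots,B_D$ so enumerated, and $b\in\mathbb{R}^D$ is its coefficient vector. The smaller tensor product space obtained by omitting the $j$-th marginal basis is defined in the same way from the $p-1$ remaining marginal bases, with the same lexicographic enumeration. $x_{-j}\in[0,1]^{p-1}$ denotes $x=(x_1,\dots,x_p)$ without its $j$-th component, and $I_d$ is the $d\times d$ identity matrix. *)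

theory Defs
  imports "HOL-Analysis.Analysis" "Jordan_Normal_Form.Matrix"
begin

unbundle no vec_syntax
hide_type (open) Finite_Cartesian_Product.vec

text \<open>
  Indices start at 0 throughout. A list \<open>ds = [d\<^sub>1, \<dots>, d\<^sub>p]\<close> holds the dimensions
  of the marginal bases, and points of the cube are lists of length \<open>p\<close>.
\<close>

text \<open>The Cox--de Boor recursion for the B-spline of degree \<open>k\<close> with knots
  \<open>t i, \<dots>, t (i + k + 1)\<close>.\<close>

fun bspline :: "(nat \<Rightarrow> real) \<Rightarrow> nat \<Rightarrow> nat \<Rightarrow> real \<Rightarrow> real" where
  "bspline t 0 i x = (if t i \<le> x \<and> x < t (i + 1) then 1 else 0)"
| "bspline t (Suc k) i x =
     (x - t i) / (t (i + k + 1) - t i) * bspline t k i x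
   + (t (i + k + 2) - x) / (t (i + k + 2) - t (i + 1)) * bspline t k (i + 1) x"

text \<open>
  A cubic basis of dimension \<open>d \<ge> 4\<close> uses the \<open>d + 4\<close> knots with indices \<open>0, \<dots>, d + 3\<close>.
  They are equally spaced, with \<open>knot d 3 = 0\<close> and \<open>knot d d = 1\<close>; three knots lie on either
  side of the unit interval.
\<close>

definition knot :: "nat \<Rightarrow> nat \<Rightarrow> real" where
  "knot d i = (real i - 3) / (real d - 3)"

definition cubic_bspline :: "nat \<Rightarrow> nat \<Rightarrow> real \<Rightarrow> real" where
  "cubic_bspline d l = bspline (knot d) 3 l"

definition unit_cube :: "nat \<Rightarrow> real list set" where
  "unit_cube p = {x. length x = p \<and> set x \<subseteq> {0..1}}"

text \<open>\<open>product_lists\<close> enumerates lexicographically, with the last index varying fastest.\<close>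

definition multi_index :: "nat list \<Rightarrow> nat \<Rightarrow> nat list" where
  "multi_index ds l = product_lists (map (\<lambda>d. [0..<d]) ds) ! l"

definition tensor_bspline :: "nat list \<Rightarrow> nat \<Rightarrow> real list \<Rightarrow> real" where
  "tensor_bspline ds l x =
     (\<Prod>j<length ds. cubic_bspline (ds ! j) (multi_index ds l ! j) (x ! j))"

definition is_coeff_vec :: "nat list \<Rightarrow> (real list \<Rightarrow> real) \<Rightarrow> real vec \<Rightarrow> bool" where
  "is_coeff_vec ds f b \<longleftrightarrow>
     b \<in> carrier_vec (prod_list ds) \<and>
     (\<forall>x\<in>unit_cube (length ds). f x = (\<Sum>l<prod_list ds. b $ l * tensor_bspline ds l x))"

definition tensor_spline :: "nat list \<Rightarrow> (real list \<Rightarrow> real) \<Rightarrow> bool" where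
  "tensor_spline ds f \<longleftrightarrow> (\<exists>b. is_coeff_vec ds f b)"

definition omit :: "nat \<Rightarrow> 'a list \<Rightarrow> 'a list" where
  "omit j xs = take j xs @ drop (Suc j) xs"

text \<open>The argument \<open>y\<close> is the point without its component at position \<open>j\<close>, where the
  integration variable is inserted.\<close>

definition integrate_out :: "nat \<Rightarrow> (real list \<Rightarrow> real) \<Rightarrow> real list \<Rightarrow> real" where
  "integrate_out j f y = integral {0..1} (\<lambda>t. f (take j y @ t # drop j y))"

definition kronecker :: "real mat \<Rightarrow> real mat \<Rightarrow> real mat" where
  "kronecker A B = mat (dim_row A * dim_row B) (dim_col A * dim_col B)
     (\<lambda>(r, c). A $$ (r div dim_row B, c div dim_col B) * B $$ (r mod dim_row B, c mod dim_col B))"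

definition kronecker_list :: "real mat list \<Rightarrow> real mat" where
  "kronecker_list As = foldr kronecker As (1\<^sub>m 1)"

definition integral_row :: "nat \<Rightarrow> real mat" where
  "integral_row d = mat 1 d (\<lambda>(_, l). integral {0..1} (cubic_bspline d l))"

definition integration_matrix :: "nat list \<Rightarrow> nat \<Rightarrow> real mat" where
  "integration_matrix ds j =
     kronecker_list (map 1\<^sub>m (take j ds) @ integral_row (ds ! j) # map 1\<^sub>m (drop (Suc j) ds))"

end

theory Submission
  imports Defs
begin

text \<open>
  By linearity it suffices to integrate one tensor product B-spline. Along the Kronecker
  factorisation the row and column indices split by division with remainder, exactly as the
  lexicographic index of the tensor product B-splines does, so peeling off the first marginal
  basis gives an induction on \<open>j\<close>.
\<close>

section \<open>Integrability of B-splines\<close>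

text \<open>The continuous factor \<open>q\<close> absorbs the affine weights of the Cox--de Boor recursion.\<close>

lemma integrable_continuous_mult_bspline:
  assumes "continuous_on {a..b} q"
  shows "(\<lambda>x. q x * bspline t k i x) integrable_on {a..b}"
  using assms
proof (induction k arbitrary: q i)
  case 0
  have "{t i..t (i + 1)} \<inter> {a..b} = {max (t i) a..min (t (i + 1)) b}"
    by (rule Int_atLeastAtMost)
  moreover have "q integrable_on {max (t i) a..min (t (i + 1)) b}"
    by (intro integrable_continuous_real continuous_on_subset[OF 0]) auto
  ultimately have "(\<lambda>x. if x \<in> {t i..t (i + 1)} then q x else 0) integrable_on {a..b}"
    by (metis integrable_restrict_Int)
  \<comment> \<open>The degree-0 B-spline is the indicator of a half-open interval; passing from the
    closed one changes the integrand at most at the right knot, a null set.\<close>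
  then show ?case
    by (rule integrable_spike[of _ _ "{t (i + 1)}"]) auto
next
  case (Suc k)
  \<comment> \<open>Each weight joins \<open>q\<close> in the continuous factor of the induction
    hypothesis. Since \<open>t\<close> is arbitrary, knots may coincide; division is read as
    multiplication by an inverse, so continuity asks for no nonzero denominator.\<close>
  have "(\<lambda>x. (q x * ((x - t i) / (t (i + k + 1) - t i))) * bspline t k i x) integrable_on {a..b}"
    "(\<lambda>x. (q x * ((t (i + k + 2) - x) / (t (i + k + 2) - t (i + 1)))) * bspline t k (i + 1) x)
      integrable_on {a..b}"
    unfolding divide_inverse by (intro Suc continuous_intros)+
  from integrable_add[OF this] show ?case
    by (simp add: algebra_simps)
qed

lemma integrable_cubic_bspline: "cubic_bspline d l integrable_on {a..b}"
  using integrable_continuous_mult_bspline[of a b "\<lambda>_. 1" "knot d" 3 l]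
  by (simp add: cubic_bspline_def)

section \<open>Splitting lexicographic indices\<close>

text \<open>The range is cut into \<open>m\<close> blocks of length \<open>n\<close>, with
  \<open>r = i * n + k\<close> in block \<open>i\<close> at offset \<open>k\<close>.\<close>

lemma sum_lessThan_mult_div_mod:
  "(\<Sum>r<m * n. g (r div n) (r mod n)) = (\<Sum>i<m. \<Sum>k<n. g i k)" for m n :: nat
proof -
  have "(\<Sum>r<m * n. g (r div n) (r mod n)) = (\<Sum>i<m. \<Sum>r = i * n..<i * n + n. g (r div n) (r mod n))"
    by (rule sum.nat_group[symmetric])
  also have "\<dots> = (\<Sum>i<m. \<Sum>k<n. g i k)"
  proof (rule sum.cong[OF refl])
    fix i
    have "(\<Sum>r = i * n..<i * n + n. g (r div n) (r mod n))
        = (\<Sum>k = 0..<n. g ((k + i * n) div n) ((k + i * n) mod n))"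
      using sum.shift_bounds_nat_ivl[of "\<lambda>r. g (r div n) (r mod n)" 0 "i * n" n]
      by (simp add: add.commute)
    also have "\<dots> = (\<Sum>k<n. g i k)"
      by (auto simp: atLeast0LessThan intro!: sum.cong)
    finally show "(\<Sum>r = i * n..<i * n + n. g (r div n) (r mod n)) = (\<Sum>k<n. g i k)" .
  qed
  finally show ?thesis .
qed

text \<open>Skipping the first block lowers the quotient by one and keeps the remainder. This serves
  \<open>product_lists\<close>, which is a concatenation of blocks of equal length, one for each
  value of the first index.\<close>

lemma concat_nth_uniform:
  assumes "\<And>xs. xs \<in> set xss \<Longrightarrow> length xs = n" and "l < length xss * n"
  shows "concat xss ! l = xss ! (l div n) ! (l mod n)"
  using assms
proof (induction xss arbitrary: l)
  case (Cons xs xss)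
  show ?case
  proof (cases "l < n")
    case True
    then show ?thesis
      using Cons.prems by (simp add: nth_append)
  next
    case False
    then have "n > 0"
      using Cons.prems by (auto intro: gr0I)
    moreover have "concat xss ! (l - n) = xss ! ((l - n) div n) ! ((l - n) mod n)"
      using Cons.prems False by (intro Cons.IH) auto
    ultimately show ?thesis
      using Cons.prems False by (simp add: nth_append le_div_geq le_mod_geq)
  qed
qed simp

lemma length_product_lists_upt:
  "length (product_lists (map (\<lambda>d. [0..<d]) ds)) = prod_list ds"
  by (induction ds) (simp_all add: length_concat comp_def sum_list_triv)

lemma multi_index_Cons:
  assumes "l < d * prod_list ds"
  shows "multi_index (d # ds) l = (l div prod_list ds) # multi_index ds (l mod prod_list ds)"
proof -
  let ?P = "product_lists (map (\<lambda>d. [0..<d]) ds)"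
  have "prod_list ds > 0"
    using assms by (auto intro: gr0I)
  moreover have "l div prod_list ds < d"
    using assms by (simp add: less_mult_imp_div_less)
  moreover have "concat (map (\<lambda>i. map ((#) i) ?P) [0..<d]) ! l
      = map (\<lambda>i. map ((#) i) ?P) [0..<d] ! (l div prod_list ds) ! (l mod prod_list ds)"
    using assms by (intro concat_nth_uniform) (auto simp: length_product_lists_upt)
  ultimately show ?thesis
    by (simp add: multi_index_def length_product_lists_upt)
qed

lemma tensor_bspline_Cons:
  assumes "l < d * prod_list ds"
  shows "tensor_bspline (d # ds) l (x # xs) =
    cubic_bspline d (l div prod_list ds) x * tensor_bspline ds (l mod prod_list ds) xs"
  by (simp add: tensor_bspline_def multi_index_Cons[OF assms] prod.lessThan_Suc_shift
      del: prod.lessThan_Suc)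

section \<open>Kronecker products\<close>

lemma dim_kronecker [simp]:
  "dim_row (kronecker A B) = dim_row A * dim_row B"
  "dim_col (kronecker A B) = dim_col A * dim_col B"
  by (simp_all add: kronecker_def)

lemma index_kronecker:
  assumes "r < dim_row A * dim_row B" and "c < dim_col A * dim_col B"
  shows "kronecker A B $$ (r, c) =
    A $$ (r div dim_row B, c div dim_col B) * B $$ (r mod dim_row B, c mod dim_col B)"
  using assms by (simp add: kronecker_def)

lemma kronecker_one: "kronecker (1\<^sub>m m) (1\<^sub>m n) = 1\<^sub>m (m * n)"
proof (rule eq_matI)
  fix r c
  assume "r < dim_row (1\<^sub>m (m * n) :: real mat)" and "c < dim_col (1\<^sub>m (m * n) :: real mat)"
  then have rc: "r < m * n" "c < m * n"
    by simp_all
  then have "n > 0"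
    by (auto intro: gr0I)
  moreover have "r div n < m" "c div n < m"
    using rc by (simp_all add: less_mult_imp_div_less)
  \<comment> \<open>Quotient and remainder determine a number, so off the diagonal one of the two
    identity factors vanishes.\<close>
  moreover have "r div n \<noteq> c div n \<or> r mod n \<noteq> c mod n" if "r \<noteq> c"
    using that div_mult_mod_eq[of r n] div_mult_mod_eq[of c n] by metis
  ultimately show "kronecker (1\<^sub>m m) (1\<^sub>m n) $$ (r, c) = 1\<^sub>m (m * n) $$ (r, c)"
    using rc by (cases "r = c") (auto simp: index_kronecker)
qed simp_all

lemma kronecker_list_simps:
  "kronecker_list [] = 1\<^sub>m 1"
  "kronecker_list (A # As) = kronecker A (kronecker_list As)"
  by (simp_all add: kronecker_list_def)

lemma kronecker_list_one: "kronecker_list (map 1\<^sub>m ds) = 1\<^sub>m (prod_list ds)"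
  by (induction ds) (simp_all add: kronecker_list_simps kronecker_one)

text \<open>This is the base of the recursion on \<open>j\<close>: with nothing before the
  integrated variable, all identities to its right merge into one.\<close>

lemma integration_matrix_Cons_0:
  "integration_matrix (d # ds) 0 = kronecker (integral_row d) (1\<^sub>m (prod_list ds))"
  by (simp add: integration_matrix_def kronecker_list_simps kronecker_list_one)

lemma integration_matrix_Cons_Suc:
  "integration_matrix (d # ds) (Suc j) = kronecker (1\<^sub>m d) (integration_matrix ds j)"
  by (simp add: integration_matrix_def kronecker_list_simps)

lemma omit_Cons [simp]: "omit 0 (x # xs) = xs" "omit (Suc j) (x # xs) = x # omit j xs"
  by (simp_all add: omit_def)

text \<open>The entry formula for Kronecker products divides by the dimensions of the right factor.
  These are also the block lengths in the lexicographic enumerations before and after the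
  omission.\<close>

lemma dim_integration_matrix:
  assumes "j < length ds"
  shows "dim_row (integration_matrix ds j) = prod_list (omit j ds)"
    and "dim_col (integration_matrix ds j) = prod_list ds"
proof -
  have "dim_row (integration_matrix ds j) = prod_list (omit j ds) \<and>
    dim_col (integration_matrix ds j) = prod_list ds"
    using assms
  proof (induction j arbitrary: ds)
    case 0
    then show ?case
      by (cases ds) (simp_all add: integration_matrix_Cons_0 integral_row_def)
  next
    case (Suc j)
    then show ?case
      by (cases ds) (simp_all add: integration_matrix_Cons_Suc)
  qed
  then show "dim_row (integration_matrix ds j) = prod_list (omit j ds)"
    and "dim_col (integration_matrix ds j) = prod_list ds"
    by simp_all
qed

section \<open>Integrating out one variable\<close>

text \<open>Column \<open>l\<close> of the matrix holds the coefficients of the integrated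
  \<open>l\<close>-th tensor product B-spline. The form \<open>has_integral\<close> carries
  integrability along with the value, so that finite linear combinations can be integrated
  termwise.\<close>

lemma has_integral_tensor_bspline:
  assumes "j < length ds" and "l < prod_list ds" and "Suc (length y) = length ds"
  shows "((\<lambda>t. tensor_bspline ds l (take j y @ t # drop j y)) has_integral
    (\<Sum>r<prod_list (omit j ds).
      integration_matrix ds j $$ (r, l) * tensor_bspline (omit j ds) r y)) {0..1}"
  using assms
proof (induction j arbitrary: ds l y)
  case 0
  then obtain d es where ds: "ds = d # es"
    by (cases ds) auto
  let ?N = "prod_list es" and ?I = "integral {0..1} (cubic_bspline d (l div prod_list es))"
  have l: "l < d * ?N"
    using 0 ds by simp
  then have "?N > 0"
    by (auto intro: gr0I)
  then have lmod: "l mod ?N < ?N"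
    by simp
  have ldiv: "l div ?N < d"
    using l by (simp add: less_mult_imp_div_less)
  \<comment> \<open>The left factor has a single row, so \<open>r div ?N = 0\<close> and
    \<open>r mod ?N = r\<close>; the identity on the right then selects
    \<open>r = l mod ?N\<close>.\<close>
  have "integration_matrix ds 0 $$ (r, l) = ?I * (if r = l mod ?N then 1 else 0)"
    if "r < ?N" for r
    using that l lmod ldiv
    by (simp add: ds integration_matrix_Cons_0 index_kronecker integral_row_def)
  then have "(\<Sum>r<?N. integration_matrix ds 0 $$ (r, l) * tensor_bspline es r y)
      = (\<Sum>r<?N. if r = l mod ?N then ?I * tensor_bspline es r y else 0)"
    by (intro sum.cong) auto
  also have "\<dots> = ?I * tensor_bspline es (l mod ?N) y"
    using lmod by simp
  finally show ?case
    using has_integral_mult_left[OF integrable_integral[OF integrable_cubic_bspline]] l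
    by (simp add: ds tensor_bspline_Cons)
next
  case (Suc j)
  then obtain d es y0 ys where ds: "ds = d # es" and y: "y = y0 # ys"
    by (cases ds; cases y) auto
  let ?N = "prod_list es" and ?N' = "prod_list (omit j es)" and ?M = "integration_matrix es j"
  let ?B = "\<lambda>i. cubic_bspline d i y0"
  have j: "j < length es" and l: "l < d * ?N" and len: "Suc (length ys) = length es"
    using Suc.prems ds y by simp_all
  then have "?N > 0"
    by (auto intro: gr0I)
  then have lmod: "l mod ?N < ?N"
    by simp
  have ldiv: "l div ?N < d"
    using l by (simp add: less_mult_imp_div_less)
  have dims: "dim_row ?M = ?N'" "dim_col ?M = ?N"
    using dim_integration_matrix[OF j] by auto
  \<comment> \<open>This is the summand in terms of block \<open>i\<close> and offset
    \<open>k\<close>. The Kronecker delta comes from the identity factor of the first basis and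
    leaves only the block \<open>i = l div ?N\<close>.\<close>
  define g where "g = (\<lambda>i k. (if i = l div ?N then 1 else 0) * ?M $$ (k, l mod ?N)
    * (?B i * tensor_bspline (omit j es) k ys))"
  \<comment> \<open>Rows split by \<open>?N'\<close> and columns by \<open>?N\<close>; the B-spline
    index \<open>r\<close> of the smaller space splits by the same \<open>?N'\<close>, so both
    factors depend on the same pair.\<close>
  have entry: "integration_matrix ds (Suc j) $$ (r, l) * tensor_bspline (omit (Suc j) ds) r y
      = g (r div ?N') (r mod ?N')" if "r < d * ?N'" for r
    using that l ldiv
    by (simp add: ds y g_def integration_matrix_Cons_Suc index_kronecker dims
        tensor_bspline_Cons less_mult_imp_div_less)
  have "(\<Sum>r<prod_list (omit (Suc j) ds).
      integration_matrix ds (Suc j) $$ (r, l) * tensor_bspline (omit (Suc j) ds) r y)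
      = (\<Sum>r<d * ?N'. g (r div ?N') (r mod ?N'))"
    using entry by (simp add: ds)
  also have "\<dots> = (\<Sum>i<d. \<Sum>k<?N'. g i k)"
    by (rule sum_lessThan_mult_div_mod)
  also have "\<dots> = (\<Sum>i<d. if i = l div ?N
      then ?B i * (\<Sum>k<?N'. ?M $$ (k, l mod ?N) * tensor_bspline (omit j es) k ys) else 0)"
    by (intro sum.cong) (auto simp: g_def sum_distrib_left algebra_simps)
  also have "\<dots> = ?B (l div ?N) *
      (\<Sum>k<?N'. ?M $$ (k, l mod ?N) * tensor_bspline (omit j es) k ys)"
    using ldiv by simp
  \<comment> \<open>The first coordinate \<open>y0\<close> stays fixed, so its marginal B-spline is
    a constant factor under the integral.\<close>
  finally show ?case
    using has_integral_mult_right[OF Suc.IH[OF j lmod len], of "?B (l div ?N)"] l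
    by (simp add: ds y tensor_bspline_Cons)
qed

lemma insert_mem_unit_cube:
  assumes "y \<in> unit_cube n" and "t \<in> {0..1}"
  shows "take j y @ t # drop j y \<in> unit_cube (Suc n)"
  using assms by (auto simp: unit_cube_def dest: in_set_takeD in_set_dropD)

lemma length_omit: "j < length xs \<Longrightarrow> Suc (length (omit j xs)) = length xs"
  by (simp add: omit_def)

lemma is_coeff_vec_integrate_out:
  assumes j: "j < length ds" and b: "is_coeff_vec ds f b"
  shows "is_coeff_vec (omit j ds) (integrate_out j f) (integration_matrix ds j *\<^sub>v b)"
proof -
  let ?N = "prod_list ds" and ?N' = "prod_list (omit j ds)" and ?M = "integration_matrix ds j"
  let ?T = "tensor_bspline (omit j ds)"
  have M: "?M \<in> carrier_mat ?N' ?N"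
    using dim_integration_matrix[OF j] by (intro carrier_matI)
  have bN: "b \<in> carrier_vec ?N"
    and f: "\<And>x. x \<in> unit_cube (length ds) \<Longrightarrow> f x = (\<Sum>l<?N. b $ l * tensor_bspline ds l x)"
    using b by (auto simp: is_coeff_vec_def)
  have "integrate_out j f y = (\<Sum>r<?N'. (?M *\<^sub>v b) $ r * ?T r y)"
    if y: "y \<in> unit_cube (length (omit j ds))" for y
  proof -
    have len: "Suc (length y) = length ds"
      using y length_omit[OF j] by (simp add: unit_cube_def)
    \<comment> \<open>The expansion of \<open>f\<close> is known only on the unit cube, hence the
      check that inserting \<open>t\<close> into \<open>y\<close> stays there.\<close>
    have "integrate_out j f y
        = integral {0..1} (\<lambda>t. \<Sum>l<?N. b $ l * tensor_bspline ds l (take j y @ t # drop j y))"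
      unfolding integrate_out_def
      using insert_mem_unit_cube[OF y] length_omit[OF j] by (intro integral_cong f) auto
    also have "\<dots> = (\<Sum>l<?N. b $ l * (\<Sum>r<?N'. ?M $$ (r, l) * ?T r y))"
      using j len by (intro integral_unique has_integral_sum has_integral_mult_right
          has_integral_tensor_bspline) auto
    \<comment> \<open>After the interchange the inner sum is row \<open>r\<close> of
      \<open>?M\<close> applied to \<open>b\<close>, times \<open>?T r y\<close>.\<close>
    also have "\<dots> = (\<Sum>r<?N'. \<Sum>l<?N. b $ l * (?M $$ (r, l) * ?T r y))"
      by (simp only: sum_distrib_left) (rule sum.swap)
    also have "\<dots> = (\<Sum>r<?N'. (?M *\<^sub>v b) $ r * ?T r y)"
      using M bN
      by (intro sum.cong)
        (auto simp: scalar_prod_def atLeast0LessThan sum_distrib_left ac_simps)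
    finally show ?thesis .
  qed
  then show ?thesis
    using M bN by (auto simp: is_coeff_vec_def)
qed

theorem proposition4p2:
  fixes ds :: "nat list" and j :: nat and f :: "real list \<Rightarrow> real"
  assumes "length ds \<ge> 2"
    and "\<forall>d\<in>set ds. d \<ge> 4"
    and "j < length ds"
    and "tensor_spline ds f"
  shows "tensor_spline (omit j ds) (integrate_out j f) \<and>
    (\<forall>b. is_coeff_vec ds f b \<longrightarrow>
       is_coeff_vec (omit j ds) (integrate_out j f) (integration_matrix ds j *\<^sub>v b))"
  using assms(3,4) is_coeff_vec_integrate_out unfolding tensor_spline_def by blast

end
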